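(* Consider a general contribution game with uniform budgets ($B_v=1$ for all $v\in V$) and reward functions $f_e(s_e)=h_e(\min_{u\in e}s_u(e))$ for all $e\in E$, where all $h_e$ are convex. Then a setwise equilibrium always exists. If all $h_e$ are strictly convex, all setwise equilibria are integral.
   Context: General contribution game: a finite hypergraph $G=(V,E)$, where each node $v\in V$ is a player with budget $B_v\ge0$ and each hyperedge $e\in E$, $e\subseteq V$, is a joint project of a set of players. A strategy of player $v$ assigns an effort $s_v(e)\ge 0$ to each hyperedge $e\ni v$ with $\sum_{e\ni v}s_v(e)\le B_v$; a state $s=(s_v)_{v\in V}$ consists of one strategy per player. Each hyperedge has a reward function $f_e:(\mathbb{R}_{\ge0})^{|e|}\to\mathbb{R}_{\ge0}$ evaluated at $s_e=(s_u(e))_{u\in e}$; here $h_e:\mathbb{R}_{\ge0}\to\mathbb{R}_{\ge0}$ is nondecreasing. The utility of $v$ is $w_v(s)=\sum_{e\ni v}f_e(s_e)$. Budgets are uniform if they are all equal; they are then normalized to $1$. A setwise equilibrium is a state $s$ such that for every $e\in E$, every nonempty $U\subseteq e$, and every joint deviation $s'_U=(s'_u)_{u\in U}$ there is at least one player $v\in U$ with $w_v(s)\ge w_v(s'_U,s_{-U})$. Convention for minimum effort games: since only the minimum contribution to a project matters, all players of a project $e$ are assumed without loss of generality to contribute the same amount to $e$ in an equilibrium (in general, take the value $\min_{u\in e}s_u(e)$). An equilibrium is integral if for every $e\in E$ this value lies in $\{0,1\}$. *)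

theory Defs
  imports "HOL-Analysis.Analysis"
begin

text \<open>A general contribution game has a finite player set \<open>V\<close>, a set \<open>E\<close> of hyperedges, budgets \<open>B\<close>
  and reward functions \<open>f\<close>. The argument of \<open>f e\<close> is an effort vector in \<open>e \<rightarrow>\<^sub>E {0..}\<close>, i.e. a
  function on \<open>e\<close> that is \<open>undefined\<close> outside of \<open>e\<close>; only its values on such vectors matter.
  Hyperedges are taken to be nonempty, so that the minimum effort in a project is meaningful.\<close>

definition contribution_game ::
  "'v set \<Rightarrow> 'v set set \<Rightarrow> ('v \<Rightarrow> real) \<Rightarrow> ('v set \<Rightarrow> ('v \<Rightarrow> real) \<Rightarrow> real) \<Rightarrow> bool" where
  "contribution_game V E B f \<longleftrightarrow>
     finite V \<and> (\<forall>e\<in>E. e \<subseteq> V \<and> e \<noteq> {}) \<and> (\<forall>v\<in>V. 0 \<le> B v) \<and>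
     (\<forall>e\<in>E. \<forall>x \<in> e \<rightarrow>\<^sub>E {0..}. 0 \<le> f e x)"

definition incident :: "'v set set \<Rightarrow> 'v \<Rightarrow> 'v set set" where
  "incident E v = {e \<in> E. v \<in> e}"

definition strategies :: "'v set set \<Rightarrow> ('v \<Rightarrow> real) \<Rightarrow> 'v \<Rightarrow> ('v set \<Rightarrow> real) set" where
  "strategies E B v =
     {x \<in> incident E v \<rightarrow>\<^sub>E {0..}. (\<Sum>e\<in>incident E v. x e) \<le> B v}"

text \<open>Joint strategies of a set \<open>U\<close> of players; for \<open>U = V\<close> these are the states.\<close>

definition joint_strategies ::
  "'v set set \<Rightarrow> ('v \<Rightarrow> real) \<Rightarrow> 'v set \<Rightarrow> ('v \<Rightarrow> 'v set \<Rightarrow> real) set" where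
  "joint_strategies E B U = (\<Pi>\<^sub>E u\<in>U. strategies E B u)"

definition utility ::
  "'v set set \<Rightarrow> ('v set \<Rightarrow> ('v \<Rightarrow> real) \<Rightarrow> real) \<Rightarrow> 'v \<Rightarrow> ('v \<Rightarrow> 'v set \<Rightarrow> real) \<Rightarrow> real" where
  "utility E f v s = (\<Sum>e\<in>incident E v. f e (\<lambda>u\<in>e. s u e))"

text \<open>The deviation profile \<open>(s'\<^sub>U, s\<^sub>-\<^sub>U)\<close> is \<open>override_on s s' U\<close>.\<close>

definition setwise_equilibrium ::
  "'v set \<Rightarrow> 'v set set \<Rightarrow> ('v \<Rightarrow> real) \<Rightarrow> ('v set \<Rightarrow> ('v \<Rightarrow> real) \<Rightarrow> real) \<Rightarrow>
     ('v \<Rightarrow> 'v set \<Rightarrow> real) \<Rightarrow> bool" where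
  "setwise_equilibrium V E B f s \<longleftrightarrow>
     s \<in> joint_strategies E B V \<and>
     (\<forall>e\<in>E. \<forall>U. U \<subseteq> e \<and> U \<noteq> {} \<longrightarrow>
        (\<forall>s' \<in> joint_strategies E B U.
           \<exists>v\<in>U. utility E f v s \<ge> utility E f v (override_on s s' U)))"

text \<open>Players of a project need not contribute equal amounts here; what counts is the minimum.\<close>

definition integral_state :: "'v set set \<Rightarrow> ('v \<Rightarrow> 'v set \<Rightarrow> real) \<Rightarrow> bool" where
  "integral_state E s \<longleftrightarrow> (\<forall>e\<in>E. (MIN u\<in>e. s u e) \<in> {0, 1})"

definition strictly_convex_on :: "'a::real_vector set \<Rightarrow> ('a \<Rightarrow> real) \<Rightarrow> bool" where
  "strictly_convex_on S g \<longleftrightarrow> convex S \<and>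
     (\<forall>x\<in>S. \<forall>y\<in>S. \<forall>t. x \<noteq> y \<and> 0 < t \<and> t < 1 \<longrightarrow>
        g ((1 - t) *\<^sub>R x + t *\<^sub>R y) < (1 - t) * g x + t * g y)"

end

theory Submission
  imports Defs
begin

text \<open>Write \<open>g e = h e 1 - h e 0\<close>. By convexity, a project run at level \<open>x \<in> [0,1]\<close> yields at most
  \<open>x * g e\<close> above its base reward \<open>h e 0\<close>, so a player with unit budget never gains more than the
  largest \<open>g e\<close> among the projects he helps to run. For existence, choose disjoint projects
  greedily by decreasing \<open>g\<close> and let their members invest everything there. In a profitable
  deviation, the best-off deviator would need a project with larger \<open>g\<close>; such a project
  shares with a chosen one of no smaller \<open>g\<close> a player who, being better off than all deviators,
  does not deviate and so contributes 0 to it.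
  For integrality, among all projects with level strictly between 0 and 1 take one with maximal
  \<open>g\<close>. If all its members move their whole budget to it, strict convexity makes each of them
  strictly better off.\<close>

section \<open>Greedy selection of disjoint sets\<close>

lemma ex_greedy_disjoint_subfamily:
  fixes g :: "'a set \<Rightarrow> 'b::linorder"
  assumes "finite E" and "{} \<notin> E"
  shows "\<exists>M\<subseteq>E. disjoint M \<and> (\<forall>e\<in>E. \<exists>m\<in>M. m \<inter> e \<noteq> {} \<and> g e \<le> g m)"
  using assms
proof (induction E rule: finite_psubset_induct)
  case (psubset E)
  show ?case
  proof (cases "E = {}")
    case True
    then show ?thesis by (auto simp: disjoint_def)
  next
    case False
    have "Max (g ` E) \<in> g ` E"
      using psubset.hyps False by (intro Max_in) auto
    then obtain a where a: "a \<in> E" "g a = Max (g ` E)" by auto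
    have a_max: "g e \<le> g a" if "e \<in> E" for e
      using that psubset.hyps a(2) by simp
    have "a \<noteq> {}" using a(1) psubset.prems by auto
    \<comment> \<open>Every set meeting \<open>a\<close> is already dominated by \<open>a\<close>,
      and \<open>a\<close> meets itself because it is nonempty, so the induction only has to treat
      the rest.\<close>
    define F where "F = {e \<in> E. e \<inter> a = {}}"
    have "F \<subset> E" using a(1) \<open>a \<noteq> {}\<close> by (auto simp: F_def)
    moreover have "{} \<notin> F" using psubset.prems by (auto simp: F_def)
    ultimately obtain M where M: "M \<subseteq> F" "disjoint M"
        "\<forall>e\<in>F. \<exists>m\<in>M. m \<inter> e \<noteq> {} \<and> g e \<le> g m"
      using psubset.IH[of F] by metis
    have "disjoint (insert a M)"
      using M(1,2) by (auto simp: disjoint_def F_def)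
    moreover have "\<exists>m\<in>insert a M. m \<inter> e \<noteq> {} \<and> g e \<le> g m" if "e \<in> E" for e
      using M(3) a_max that by (cases "e \<in> F") (auto simp: F_def)
    moreover have "insert a M \<subseteq> E" using M(1) a(1) by (auto simp: F_def)
    ultimately show ?thesis by (intro exI[of _ "insert a M"]) simp
  qed
qed

section \<open>Feasibility, levels of projects and utilities\<close>

lemma override_on_joint_strategies:
  assumes "s \<in> joint_strategies E B V" "s' \<in> joint_strategies E B U" "U \<subseteq> V"
  shows "override_on s s' U \<in> joint_strategies E B V"
  using assms unfolding joint_strategies_def override_on_def
  by (auto simp: PiE_iff extensional_def)

lemma joint_strategies_nonneg:
  assumes "s \<in> joint_strategies E B V" "v \<in> V" "e \<in> incident E v"
  shows "0 \<le> s v e"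
  using assms unfolding joint_strategies_def strategies_def by (auto simp: PiE_iff)

lemma joint_strategies_sum_le:
  assumes "s \<in> joint_strategies E B V" "v \<in> V"
  shows "(\<Sum>e\<in>incident E v. s v e) \<le> B v"
  using assms unfolding joint_strategies_def strategies_def by (auto simp: PiE_iff)

definition effort :: "('v \<Rightarrow> 'v set \<Rightarrow> real) \<Rightarrow> 'v set \<Rightarrow> real" where
  "effort s e = (MIN u\<in>e. s u e)"

locale min_effort_game =
  fixes V :: "'v set" and E :: "'v set set" and B :: "'v \<Rightarrow> real"
    and f :: "'v set \<Rightarrow> ('v \<Rightarrow> real) \<Rightarrow> real" and h :: "'v set \<Rightarrow> real \<Rightarrow> real"
  assumes game: "contribution_game V E B f"
    and uniform: "v \<in> V \<Longrightarrow> B v = 1"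
    and h_mono: "e \<in> E \<Longrightarrow> mono_on {0..} (h e)"
    and h_convex: "e \<in> E \<Longrightarrow> convex_on {0..} (h e)"
    and min_effort: "e \<in> E \<Longrightarrow> x \<in> e \<rightarrow>\<^sub>E {0..} \<Longrightarrow> f e x = h e (MIN u\<in>e. x u)"
begin

abbreviation states :: "('v \<Rightarrow> 'v set \<Rightarrow> real) set" where
  "states \<equiv> joint_strategies E B V"

text \<open>The slope of the chord of \<open>h e\<close> over [0,1].\<close>

definition gain :: "'v set \<Rightarrow> real" where
  "gain e = h e 1 - h e 0"

lemma finite_V: "finite V"
  and edge_subset: "e \<in> E \<Longrightarrow> e \<subseteq> V"
  and edge_nonempty: "e \<in> E \<Longrightarrow> e \<noteq> {}"
  using game by (auto simp: contribution_game_def)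

lemma finite_E: "finite E"
  using finite_V edge_subset by (auto intro: finite_subset[of E "Pow V"])

lemma finite_incident [simp]: "finite (incident E v)"
  using finite_E by (simp add: incident_def)

lemma finite_edge: "e \<in> E \<Longrightarrow> finite e"
  using finite_subset[OF edge_subset finite_V] .

lemma gain_nonneg: "e \<in> E \<Longrightarrow> 0 \<le> gain e"
  unfolding gain_def using h_mono[of e] by (auto dest: mono_onD[of _ _ 0 1])

lemma h_le_chord:
  assumes "e \<in> E" "0 \<le> x" "x \<le> 1"
  shows "h e x \<le> h e 0 + x * gain e"
  using convex_onD[OF h_convex[OF assms(1)], of x 0 1] assms(2,3)
  by (simp add: gain_def algebra_simps)

lemma effort_le:
  assumes "e \<in> E" "v \<in> e"
  shows "effort s e \<le> s v e"
  unfolding effort_def using assms finite_edge by (intro Min_le) auto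

lemma effort_eq_const:
  assumes "e \<in> E" "\<And>u. u \<in> e \<Longrightarrow> s u e = c"
  shows "effort s e = c"
proof -
  have "(\<lambda>u. s u e) ` e = {c}" using assms edge_nonempty by auto
  then show ?thesis by (simp add: effort_def)
qed

lemma effort_nonneg:
  assumes "s \<in> states" "e \<in> E"
  shows "0 \<le> effort s e"
  unfolding effort_def
  using assms finite_edge[of e] edge_nonempty[of e] edge_subset[of e]
  by (auto simp: incident_def intro!: joint_strategies_nonneg[of s E B V])

text \<open>Each member can veto a project. Both main arguments rest on this: a new project needs
  all its members, and a player who leaves stops the project.\<close>

lemma effort_eq_0:
  assumes "s \<in> states" "e \<in> E" "v \<in> e" "s v e = 0"
  shows "effort s e = 0"
  using effort_le[of e v s] effort_nonneg[OF assms(1,2)] assms by simp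

text \<open>The level of a project never exceeds what \<open>v\<close> pays into it, so the budget
  of \<open>v\<close> bounds the levels of all projects of \<open>v\<close> together.\<close>

lemma sum_effort_le_1:
  assumes "s \<in> states" "v \<in> V"
  shows "(\<Sum>e\<in>incident E v. effort s e) \<le> 1"
proof -
  have "(\<Sum>e\<in>incident E v. effort s e) \<le> (\<Sum>e\<in>incident E v. s v e)"
    by (intro sum_mono effort_le) (auto simp: incident_def)
  also have "\<dots> \<le> 1"
    using joint_strategies_sum_le[OF assms] uniform assms(2) by simp
  finally show ?thesis .
qed

lemma effort_le_1:
  assumes "s \<in> states" "e \<in> E"
  shows "effort s e \<le> 1"
proof -
  obtain v where v: "v \<in> e" "v \<in> V" using edge_nonempty edge_subset assms(2) by blast
  have "effort s e \<le> (\<Sum>e\<in>incident E v. effort s e)"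
    using assms v
    by (intro member_le_sum effort_nonneg finite_incident) (auto simp: incident_def)
  with sum_effort_le_1[OF assms(1) v(2)] show ?thesis by simp
qed

lemma utility_eq:
  assumes "s \<in> states"
  shows "utility E f v s = (\<Sum>e\<in>incident E v. h e (effort s e))"
  unfolding utility_def
proof (intro sum.cong refl)
  fix e assume "e \<in> incident E v"
  then have e: "e \<in> E" by (simp add: incident_def)
  have "(\<lambda>u\<in>e. s u e) \<in> e \<rightarrow>\<^sub>E {0..}"
    using joint_strategies_nonneg[OF assms] edge_subset[OF e] e by (auto simp: incident_def)
  from min_effort[OF e this] show "f e (\<lambda>u\<in>e. s u e) = h e (effort s e)"
    by (simp add: effort_def cong: image_cong_simp)
qed

lemma utility_le:
  assumes "s \<in> states"
  shows "utility E f v s \<le> (\<Sum>e\<in>incident E v. h e 0) + (\<Sum>e\<in>incident E v. effort s e * gain e)"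
  unfolding utility_eq[OF assms] sum.distrib[symmetric]
  by (intro sum_mono h_le_chord effort_nonneg effort_le_1 assms) (auto simp: incident_def)

section \<open>Existence of a setwise equilibrium\<close>

definition full_effort_on :: "'v set set \<Rightarrow> 'v \<Rightarrow> 'v set \<Rightarrow> real" where
  "full_effort_on M = (\<lambda>v\<in>V. \<lambda>e\<in>incident E v. of_bool (e \<in> M))"

lemma full_effort_on_apply:
  assumes "e \<in> E" "v \<in> e"
  shows "full_effort_on M v e = of_bool (e \<in> M)"
  using assms edge_subset by (auto simp: full_effort_on_def incident_def)

lemma full_effort_on_states:
  assumes "disjoint M"
  shows "full_effort_on M \<in> states"
proof -
  have "(\<Sum>e\<in>incident E v. of_bool (e \<in> M)) \<le> (1::real)" for v
  proof -
    \<comment> \<open>Disjointness leaves at most one project of \<open>M\<close> at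
      \<open>v\<close>, so the unit budget suffices.\<close>
    have "card (incident E v \<inter> M) \<le> Suc 0"
      by (subst card_le_Suc0_iff_eq) (use assms in \<open>auto simp: disjoint_def incident_def finite_E\<close>)
    then show ?thesis by (simp add: sum.If_cases of_bool_def)
  qed
  then show ?thesis
    by (auto simp: full_effort_on_def joint_strategies_def strategies_def uniform)
qed

lemma setwise_equilibrium_full_effort_on:
  assumes "M \<subseteq> E" and disj: "disjoint M"
    and greedy: "\<And>e. e \<in> E \<Longrightarrow> \<exists>m\<in>M. m \<inter> e \<noteq> {} \<and> gain e \<le> gain m"
  shows "setwise_equilibrium V E B f (full_effort_on M)"
proof -
  define s where "s = full_effort_on M"
  note s = full_effort_on_states[OF disj, folded s_def]
  \<comment> \<open>At most one summand is nonzero; writing a sum gives the value 0 to players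
    outside all chosen projects without a case split.\<close>
  define p where "p v = (\<Sum>e\<in>incident E v. of_bool (e \<in> M) * gain e)" for v
  have p_nonneg: "0 \<le> p v" for v
    unfolding p_def by (intro sum_nonneg) (auto simp: incident_def gain_nonneg)
  have gain_le_p: "gain m \<le> p v" if "m \<in> M" "v \<in> m" for m v
  proof -
    have "of_bool (m \<in> M) * gain m \<le> p v"
      unfolding p_def using that \<open>M \<subseteq> E\<close>
      by (intro member_le_sum finite_incident mult_nonneg_nonneg gain_nonneg) (auto simp: incident_def)
    with that show ?thesis by simp
  qed
  have utility_s: "utility E f v s = (\<Sum>e\<in>incident E v. h e 0) + p v" for v
    unfolding utility_eq[OF s] p_def sum.distrib[symmetric]
  proof (intro sum.cong refl)
    fix e assume "e \<in> incident E v"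
    then have e: "e \<in> E" by (simp add: incident_def)
    have "effort s e = of_bool (e \<in> M)"
      using e by (intro effort_eq_const) (simp_all add: s_def full_effort_on_apply)
    then show "h e (effort s e) = h e 0 + of_bool (e \<in> M) * gain e"
      by (simp add: gain_def)
  qed
  \<comment> \<open>This is shown for arbitrary coalitions in \<open>V\<close>, which is stronger
    than for subsets of a single project.\<close>
  have "\<exists>v\<in>U. utility E f v s \<ge> utility E f v (override_on s s' U)"
    if U: "U \<subseteq> V" "U \<noteq> {}" and s': "s' \<in> joint_strategies E B U" for U s'
  proof -
    define t where "t = override_on s s' U"
    have t: "t \<in> states"
      unfolding t_def using s s' U(1) by (rule override_on_joint_strategies)
    have "finite U" using U(1) finite_V finite_subset by blast
    then have "Max (p ` U) \<in> p ` U" using U(2) by simp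
    then obtain u where u: "u \<in> U" "p u = Max (p ` U)" by auto
    have u_max: "p w \<le> p u" if "w \<in> U" for w
      using that u(2) \<open>finite U\<close> by simp
    \<comment> \<open>Only projects that run after the deviation matter; each of them has gain at
      most \<open>p u\<close>.\<close>
    have "effort t e * gain e \<le> effort t e * p u" if e: "e \<in> incident E u" for e
    proof (cases "effort t e = 0")
      case False
      have eE: "e \<in> E" and ue: "u \<in> e" using e by (auto simp: incident_def)
      have "gain e \<le> p u"
      proof (cases "e \<in> M")
        case True
        then show ?thesis using gain_le_p ue by simp
      next
        case notM: False
        obtain m w where mw: "m \<in> M" "w \<in> m" "w \<in> e" "gain e \<le> gain m"
          using greedy[OF eE] by blast
        \<comment> \<open>Since \<open>e\<close> runs in \<open>t\<close> although \<open>w\<close>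
          gave it nothing in \<open>s\<close>, \<open>w\<close> must have deviated. Hence
          \<open>gain e \<le> gain m \<le> p w \<le> p u\<close>.\<close>
        have "s w e = 0"
          using notM eE mw(3) by (simp add: s_def full_effort_on_apply)
        moreover have "t w e \<noteq> 0"
          using effort_eq_0[OF t eE mw(3)] False by blast
        ultimately have "w \<in> U"
          by (cases "w \<in> U") (simp_all add: t_def)
        then show ?thesis
          using gain_le_p[OF mw(1,2)] u_max[of w] mw(4) by linarith
      qed
      then show ?thesis using effort_nonneg[OF t eE] by (rule mult_left_mono)
    qed simp
    then have "(\<Sum>e\<in>incident E u. effort t e * gain e) \<le> (\<Sum>e\<in>incident E u. effort t e) * p u"
      by (simp add: sum_distrib_right sum_mono)
    also have "\<dots> \<le> p u"
      using sum_effort_le_1[OF t, of u] u(1) U(1) p_nonneg[of u]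
      by (intro mult_left_le_one_le sum_nonneg effort_nonneg[OF t]) (auto simp: incident_def)
    finally have "utility E f u t \<le> utility E f u s"
      using utility_le[OF t, of u] utility_s[of u] by linarith
    then show ?thesis using u(1) by (auto simp: t_def)
  qed
  then have "setwise_equilibrium V E B f s"
    unfolding setwise_equilibrium_def using s edge_subset by (meson order_trans)
  then show ?thesis by (simp add: s_def)
qed

lemma setwise_equilibrium_exists: "\<exists>s. setwise_equilibrium V E B f s"
proof -
  have "{} \<notin> E" using edge_nonempty by blast
  from ex_greedy_disjoint_subfamily[OF finite_E this, of gain] show ?thesis
    using setwise_equilibrium_full_effort_on by blast
qed

section \<open>Integrality under strict convexity\<close>

lemma setwise_equilibrium_integral:
  assumes strict: "\<And>e. e \<in> E \<Longrightarrow> strictly_convex_on {0..} (h e)"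
    and eq: "setwise_equilibrium V E B f s"
  shows "integral_state E s"
proof (rule ccontr)
  assume not_int: "\<not> integral_state E s"
  have s: "s \<in> states" using eq by (simp add: setwise_equilibrium_def)
  define F where "F = {e \<in> E. 0 < effort s e \<and> effort s e < 1}"
  have "F \<noteq> {}"
    using not_int effort_nonneg[OF s] effort_le_1[OF s]
    by (force simp: integral_state_def F_def simp flip: effort_def)
  moreover have "finite F" using finite_E by (simp add: F_def)
  ultimately have "Max (gain ` F) \<in> gain ` F" by simp
  then obtain e where e: "e \<in> F" "gain e = Max (gain ` F)" by auto
  have e_max: "gain d \<le> gain e" if "d \<in> F" for d
    using that e(2) \<open>finite F\<close> by simp
  have eE: "e \<in> E" and frac: "0 < effort s e" "effort s e < 1"
    using e(1) by (auto simp: F_def)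
  define t where "t = override_on s (restrict (full_effort_on {e}) e) e"
  have dev: "restrict (full_effort_on {e}) e \<in> joint_strategies E B e"
    using full_effort_on_states[of "{e}"] edge_subset[OF eE]
    by (auto simp: joint_strategies_def PiE_iff)
  have t: "t \<in> states"
    unfolding t_def using s dev edge_subset[OF eE] by (rule override_on_joint_strategies)
  have t_apply: "t v d = of_bool (d = e)" if "d \<in> E" "v \<in> d" "v \<in> e" for v d
    using that by (simp add: t_def override_on_def full_effort_on_apply)
  \<comment> \<open>The equilibrium condition for the coalition \<open>e\<close> yields a member
    \<open>v\<close> who does not profit; the rest shows that \<open>v\<close> does.\<close>
  obtain v where v: "v \<in> e" and le: "utility E f v t \<le> utility E f v s"
    using eq eE dev edge_nonempty[OF eE] unfolding setwise_equilibrium_def t_def by blast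
  have vV: "v \<in> V" using v edge_subset[OF eE] by auto
  have e_inc: "e \<in> incident E v" using v eE by (simp add: incident_def)
  define D where "D = incident E v - {e}"
  have D_E: "d \<in> E" and D_v: "v \<in> d" if "d \<in> D" for d
    using that by (auto simp: D_def incident_def)
  have utility_split: "utility E f v r = h e (effort r e) + (\<Sum>d\<in>D. h d (effort r d))"
    if "r \<in> states" for r
    unfolding utility_eq[OF that] D_def by (rule sum.remove[OF finite_incident e_inc])
  have sum_split: "effort s e + (\<Sum>d\<in>D. effort s d) \<le> 1"
    using sum_effort_le_1[OF s vV]
    unfolding D_def by (simp add: sum.remove[OF finite_incident e_inc])
  have "effort t e = 1"
    using t_apply[OF eE] by (intro effort_eq_const[OF eE]) auto
  \<comment> \<open>\<open>v\<close> withdraws from all its other projects, which stops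
    them.\<close>
  moreover have "effort t d = 0" if "d \<in> D" for d
    using effort_eq_0[OF t D_E[OF that] D_v[OF that]] t_apply[OF D_E[OF that] D_v[OF that] v] that
    by (simp add: D_def)
  ultimately have utility_t: "utility E f v t = h e 1 + (\<Sum>d\<in>D. h d 0)"
    by (simp add: utility_split[OF t])
  have "effort s d * gain d \<le> effort s d * gain e" if d: "d \<in> D" for d
  proof (cases "effort s d = 0")
    case False
    \<comment> \<open>As \<open>e\<close> already takes a positive share of the budget of
      \<open>v\<close>, a running \<open>d\<close> has level below 1. So it is in \<open>F\<close>,
      where \<open>gain e\<close> is maximal.\<close>
    have "effort s d \<le> (\<Sum>d\<in>D. effort s d)"
      using d D_E by (intro member_le_sum) (auto simp: D_def effort_nonneg[OF s])
    then have "d \<in> F"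
      using False effort_nonneg[OF s D_E[OF d]] sum_split frac D_E[OF d] by (simp add: F_def)
    then show ?thesis
      using e_max effort_nonneg[OF s D_E[OF d]] by (intro mult_left_mono)
  qed simp
  then have "(\<Sum>d\<in>D. effort s d * gain d) \<le> (\<Sum>d\<in>D. effort s d) * gain e"
    by (simp add: sum_distrib_right sum_mono)
  also have "\<dots> \<le> (1 - effort s e) * gain e"
    using sum_split gain_nonneg[OF eE] by (intro mult_right_mono) auto
  finally have loss: "(\<Sum>d\<in>D. effort s d * gain d) \<le> (1 - effort s e) * gain e" .
  have "(\<Sum>d\<in>D. h d (effort s d)) \<le> (\<Sum>d\<in>D. h d 0 + effort s d * gain d)"
    by (intro sum_mono h_le_chord effort_nonneg[OF s] effort_le_1[OF s] D_E)
  also have "\<dots> = (\<Sum>d\<in>D. h d 0) + (\<Sum>d\<in>D. effort s d * gain d)"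
    by (rule sum.distrib)
  finally have others: "(\<Sum>d\<in>D. h d (effort s d)) \<le> (\<Sum>d\<in>D. h d 0) + (1 - effort s e) * gain e"
    using loss by linarith
  \<comment> \<open>Strictness enters here, with a weight strictly between 0 and 1: raising
    \<open>e\<close> to level 1 earns more than \<open>(1 - effort s e) * gain e\<close>, the bound
    on what \<open>v\<close> loses elsewhere.\<close>
  have "h e ((1 - effort s e) *\<^sub>R 0 + effort s e *\<^sub>R 1)
      < (1 - effort s e) * h e 0 + effort s e * h e 1"
    using strict[OF eE] frac unfolding strictly_convex_on_def
    by (metis atLeast_iff order_refl zero_le_one zero_neq_one)
  then have "h e (effort s e) < h e 1 - (1 - effort s e) * gain e"
    by (simp add: gain_def algebra_simps)
  with others have "utility E f v s < utility E f v t"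
    unfolding utility_t utility_split[OF s] by linarith
  with le show False by simp
qed

end

theorem corollary8p3:
  fixes V :: "'v set" and E :: "'v set set" and B :: "'v \<Rightarrow> real"
    and f :: "'v set \<Rightarrow> ('v \<Rightarrow> real) \<Rightarrow> real" and h :: "'v set \<Rightarrow> real \<Rightarrow> real"
  assumes game: "contribution_game V E B f"
    and uniform: "\<forall>v\<in>V. B v = 1"
    and h_nonneg: "\<forall>e\<in>E. \<forall>x\<ge>0. 0 \<le> h e x"
    and h_mono: "\<forall>e\<in>E. mono_on {0..} (h e)"
    and h_convex: "\<forall>e\<in>E. convex_on {0..} (h e)"
    and min_effort: "\<forall>e\<in>E. \<forall>x \<in> e \<rightarrow>\<^sub>E {0..}. f e x = h e (MIN u\<in>e. x u)"
  shows "(\<exists>s. setwise_equilibrium V E B f s) \<and>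
         ((\<forall>e\<in>E. strictly_convex_on {0..} (h e)) \<longrightarrow>
            (\<forall>s. setwise_equilibrium V E B f s \<longrightarrow> integral_state E s))"
proof -
  interpret min_effort_game V E B f h
    using assms by unfold_locales auto
  show ?thesis
    using setwise_equilibrium_exists setwise_equilibrium_integral by blast
qed

end
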